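(* Let $B=B'(p)\subseteq\mathbb{R}^S$ be an integral base-polyhedron. For any minimizer $x_{\mathbb{R}}\in\mathbb{R}^S$ of the piecewise-linear function $\overline{W}$ over $B$, there exists a decreasingly minimal element $m_{\mathbb{Z}}$ of the associated M-convex set $B\cap\mathbb{Z}^S$ satisfying $$\lfloor x_{\mathbb{R}}\rfloor\le m_{\mathbb{Z}}\le\lceil x_{\mathbb{R}}\rceil,$$ where rounding and inequalities are componentwise.
   Context: $S$ is a finite non-empty set. For $x\in\mathbb{R}^S$ and $Z\subseteq S$, $\widetilde x(Z):=\sum_{s\in Z}x(s)$. A set-function $p:2^S\to\mathbb{Z}\cup\{-\infty\}$ with $p(\emptyset)=0$ is supermodular if $p(X)+p(Y)\le p(X\cap Y)+p(X\cup Y)$ for all $X,Y$ with finite $p$-values. For an integer-valued supermodular $p$ with $p(S)$ finite, the integral base-polyhedron is $B=B'(p):=\{x\in\mathbb{R}^S:\widetilde x(S)=p(S),\ \widetilde x(Z)\ge p(Z)\text{ for every }Z\subset S\}$, and the associated M-convex set is $B\cap\mathbb{Z}^S$. An element $m$ of a set $P\subseteq\mathbb{R}^S$ is decreasingly minimal (dec-min) in $P$ if the vector of its components sorted in non-increasing order is lexicographically smallest among those of elements of $P$. $\overline{\varphi}:\mathbb{R}\to\mathbb{R}$ is the piecewise-linear extension of $k\mapsto k^2$ $(k\in\mathbb{Z})$, whose graph consists of the line segments connecting $(k,k^2)$ and $(k+1,(k+1)^2)$ for all $k\in\mathbb{Z}$; that is, $\overline{\varphi}(\xi)=(2k+1)|\xi|-k(k+1)$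 with $k=\lfloor|\xi|\rfloor$. Then $\overline{W}(x):=\sum_{s\in S}\overline{\varphi}(x(s))$ for $x\in\mathbb{R}^S$. *)

theory Defs
  imports "HOL-Analysis.Analysis" "HOL-Library.Multiset"
begin

text \<open>The finite non-empty ground set \<open>S\<close> is the universe of a type \<open>'s::finite\<close>, so that
  \<open>real ^ 's\<close> is the space of real vectors indexed by \<open>S\<close> and \<open>UNIV\<close> plays the role of \<open>S\<close>.\<close>

definition set_sum :: "real ^ 's \<Rightarrow> 's::finite set \<Rightarrow> real" where
  "set_sum x Z = (\<Sum>s\<in>Z. x $ s)"

text \<open>The supermodular inequality is only imposed where both values on the left are finite;
  the right-hand side is then required to be finite as well.\<close>

definition int_supermodular :: "('s::finite set \<Rightarrow> ereal) \<Rightarrow> bool" where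
  "int_supermodular p \<longleftrightarrow>
     (\<forall>X. p X = -\<infinity> \<or> (\<exists>k::int. p X = ereal (of_int k))) \<and>
     p {} = 0 \<and>
     (\<forall>X Y. p X \<noteq> -\<infinity> \<and> p Y \<noteq> -\<infinity> \<longrightarrow> p X + p Y \<le> p (X \<inter> Y) + p (X \<union> Y))"

definition base_polyhedron :: "('s::finite set \<Rightarrow> ereal) \<Rightarrow> (real ^ 's) set" where
  "base_polyhedron p =
     {x. ereal (set_sum x UNIV) = p UNIV \<and> (\<forall>Z. Z \<subset> UNIV \<longrightarrow> ereal (set_sum x Z) \<ge> p Z)}"

definition integral_vectors :: "(real ^ 's::finite) set" where
  "integral_vectors = {x. \<forall>s. x $ s \<in> \<int>}"

definition sorted_desc :: "real ^ 's::finite \<Rightarrow> real list" where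
  "sorted_desc x = rev (sorted_list_of_multiset (image_mset (\<lambda>s. x $ s) (mset_set UNIV)))"

definition dec_min :: "real ^ 's::finite \<Rightarrow> (real ^ 's) set \<Rightarrow> bool" where
  "dec_min m P \<longleftrightarrow> m \<in> P \<and>
     (\<forall>x\<in>P. sorted_desc m = sorted_desc x \<or>
            (sorted_desc m, sorted_desc x) \<in> lexord {(a, b). a < b})"

definition phi_bar :: "real \<Rightarrow> real" where
  "phi_bar \<xi> = (let k = real_of_int \<lfloor>\<bar>\<xi>\<bar>\<rfloor> in (2 * k + 1) * \<bar>\<xi>\<bar> - k * (k + 1))"

text \<open>The closed formula agrees with the description by line segments: on each interval
  \<open>[k, k + 1]\<close> it interpolates linearly between \<open>(k, k\<^sup>2)\<close> and \<open>(k + 1, (k + 1)\<^sup>2)\<close>.\<close>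

lemma phi_bar_segment:
  fixes k :: int and t :: real
  assumes "0 \<le> t" "t \<le> 1"
  shows "phi_bar (of_int k + t) = (1 - t) * (of_int k)\<^sup>2 + t * (of_int k + 1)\<^sup>2"
proof (cases "k \<ge> 0")
  case True
  then have a: "\<bar>real_of_int k + t\<bar> = of_int k + t" using assms by simp
  show ?thesis
  proof (cases "t = 1")
    case True
    then have "\<lfloor>real_of_int k + t\<rfloor> = k + 1" by simp
    then show ?thesis using True a unfolding phi_bar_def Let_def
      by (simp add: power2_eq_square algebra_simps)
  next
    case False
    then have "\<lfloor>real_of_int k + t\<rfloor> = k" using assms by (simp add: floor_eq_iff)
    then show ?thesis unfolding phi_bar_def Let_def a
      by (simp add: power2_eq_square algebra_simps)
  qed
next
  case False
  then have "real_of_int k \<le> -1" by linarith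
  then have a: "\<bar>real_of_int k + t\<bar> = - of_int k - t" using assms by simp
  show ?thesis
  proof (cases "t = 0")
    case True
    then have "\<lfloor>- real_of_int k - t\<rfloor> = - k" by (simp add: floor_eq_iff)
    then show ?thesis using True unfolding phi_bar_def Let_def a
      by (simp add: power2_eq_square algebra_simps)
  next
    case False
    then have "\<lfloor>- real_of_int k - t\<rfloor> = - k - 1" using assms by (simp add: floor_eq_iff)
    then have "real_of_int \<lfloor>- real_of_int k - t\<rfloor> = - of_int k - 1" by linarith
    then show ?thesis unfolding phi_bar_def Let_def a
      by (simp only:) (simp add: power2_eq_square algebra_simps)
  qed
qed

definition W_bar :: "real ^ 's::finite \<Rightarrow> real" where
  "W_bar x = (\<Sum>s\<in>UNIV. phi_bar (x $ s))"

end

theory Submission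
  imports Defs
begin

text \<open>
  The vectors between \<open>\<lfloor>x\<^sub>R\<rfloor>\<close> and \<open>\<lceil>x\<^sub>R\<rceil>\<close> form a box with integral corners on which
  every summand of \<open>W_bar\<close> stays on a single linear piece, so there \<open>W_bar\<close> is an affine function.
  Hence \<open>x\<^sub>R\<close> minimizes a linear functional over the intersection of \<open>B\<close> with the box. The proof
  replaces \<open>x\<^sub>R\<close> by an integral minimizer in the same box and then shows that an integral minimizer
  of \<open>W_bar\<close> over \<open>B\<close> is decreasingly minimal. Both parts rest on uncrossing: by supermodularity,
  the tight sets of an element of \<open>B\<close> are closed under unions and intersections, so each \<open>t\<close> lies
  in a smallest tight set, its tight hull, and one can shift a little weight from \<open>t\<close> to \<open>s\<close>
  without leaving \<open>B\<close> whenever \<open>s\<close> lies in the tight hull of \<open>t\<close>.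

  Integrality (\<open>integral_linear_minimizer_in_box\<close>): the minimizers in the box form a compact convex
  set, which has an extreme point. Were it fractional, there would be two fractional coordinates
  with the same tight hull (\<open>fractional_exchange_pair\<close>). Weight could then be shifted between
  them in both directions, so the point would be the midpoint of two other minimizers.

  Decreasing minimality (\<open>integral_W_bar_minimizer_dec_min\<close>): at an integral minimizer \<open>m\<close> no unit
  can be shifted from \<open>t\<close> to \<open>s\<close> if \<open>m(t) \<ge> m(s) + 2\<close>, as this would decrease the sum of squares.
  Therefore, for each integer \<open>\<beta>\<close>, the tight hulls of the elements exceeding \<open>\<beta>\<close> unite to a tight
  set on which \<open>m \<ge> \<beta>\<close> and outside of which \<open>m \<le> \<beta>\<close>. Such a set certifies that \<open>m\<close> minimizes the
  total excess over \<open>\<beta>\<close> (\<open>sum_excess_le_if_no_exchange\<close>). Having the least excess over every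
  integer threshold simultaneously forces lexicographic minimality of the sorted vector
  (\<open>lexord_if_sum_excess_le\<close>).
\<close>

section \<open>Tight sets and feasible exchanges\<close>

definition tight :: "('s::finite set \<Rightarrow> ereal) \<Rightarrow> real ^ 's \<Rightarrow> 's set \<Rightarrow> bool" where
  "tight p x Z \<longleftrightarrow> p Z = ereal (set_sum x Z)"

definition tight_hull :: "('s::finite set \<Rightarrow> ereal) \<Rightarrow> real ^ 's \<Rightarrow> 's \<Rightarrow> 's set" where
  "tight_hull p x s = \<Inter>{Z. tight p x Z \<and> s \<in> Z}"

definition exchange :: "'s::finite \<Rightarrow> 's \<Rightarrow> real ^ 's" where
  "exchange s t = axis s 1 - axis t 1"

lemma base_polyhedron_ge: "x \<in> base_polyhedron p \<Longrightarrow> p Z \<le> ereal (set_sum x Z)"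
  unfolding base_polyhedron_def by (cases "Z = UNIV") auto

lemma tight_UNIV: "x \<in> base_polyhedron p \<Longrightarrow> tight p x UNIV"
  unfolding base_polyhedron_def tight_def by auto

lemma set_sum_integral_if_tight:
  assumes "int_supermodular p" "tight p x Z"
  shows "set_sum x Z \<in> \<int>"
proof -
  have "p Z \<noteq> -\<infinity>" using assms(2) by (simp add: tight_def)
  then obtain k :: int where "p Z = ereal (of_int k)"
    using assms(1) unfolding int_supermodular_def by blast
  then have "set_sum x Z = of_int k" using assms(2) by (simp add: tight_def)
  then show ?thesis by simp
qed

lemma set_sum_Un_Int: "set_sum x (X \<inter> Y) + set_sum x (X \<union> Y) = set_sum x X + set_sum x Y"
  using sum.union_inter[of X Y "\<lambda>s. x $ s"] by (simp add: set_sum_def)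

text \<open>Uncrossing: \<open>set_sum x\<close> is modular and dominates the supermodular \<open>p\<close>, so two equalities
  \<open>p = set_sum x\<close> at \<open>X\<close> and \<open>Y\<close> leave no slack at \<open>X \<inter> Y\<close> and \<open>X \<union> Y\<close>.\<close>

lemma tight_Int_Un:
  assumes "int_supermodular p" "x \<in> base_polyhedron p" "tight p x X" "tight p x Y"
  shows "tight p x (X \<inter> Y) \<and> tight p x (X \<union> Y)"
proof -
  have "p X \<noteq> -\<infinity>" "p Y \<noteq> -\<infinity>" using assms(3,4) by (auto simp: tight_def)
  then have le: "p X + p Y \<le> p (X \<inter> Y) + p (X \<union> Y)"
    using assms(1) unfolding int_supermodular_def by blast
  note ge = base_polyhedron_ge[OF assms(2), of "X \<inter> Y"] base_polyhedron_ge[OF assms(2), of "X \<union> Y"]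
  show ?thesis
    using le ge set_sum_Un_Int[of x X Y] assms(3,4) unfolding tight_def
    by (cases "p (X \<inter> Y)"; cases "p (X \<union> Y)") auto
qed

lemma tight_Inter:
  assumes "int_supermodular p" "x \<in> base_polyhedron p"
    and "\<And>Z. Z \<in> F \<Longrightarrow> tight p x Z"
  shows "tight p x (\<Inter>F)"
proof -
  have "finite F" by simp
  then show ?thesis using assms(3)
    by (induction F) (auto simp: tight_UNIV[OF assms(2)] tight_Int_Un[OF assms(1,2)])
qed

lemma tight_Union:
  assumes "int_supermodular p" "x \<in> base_polyhedron p"
    and "\<And>Z. Z \<in> F \<Longrightarrow> tight p x Z"
  shows "tight p x (\<Union>F)"
proof -
  have empty: "tight p x {}"
    using assms(1) by (simp add: tight_def set_sum_def int_supermodular_def zero_ereal_def)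
  have "finite F" by simp
  then show ?thesis using assms(3)
  proof (induction F rule: finite_induct)
    case (insert Z F)
    then show ?case using tight_Int_Un[OF assms(1,2), of Z "\<Union>F"] by simp
  qed (simp add: empty)
qed

lemma tight_tight_hull:
  assumes "int_supermodular p" "x \<in> base_polyhedron p"
  shows "tight p x (tight_hull p x s)"
  unfolding tight_hull_def by (rule tight_Inter[OF assms]) auto

lemma mem_tight_hull: "s \<in> tight_hull p x s"
  by (auto simp: tight_hull_def)

lemma tight_hull_subset: "tight p x Z \<Longrightarrow> s \<in> Z \<Longrightarrow> tight_hull p x s \<subseteq> Z"
  by (auto simp: tight_hull_def)

lemma exchange_nth: "exchange s t $ u = of_bool (u = s) - of_bool (u = t)"
  by (auto simp: exchange_def axis_def)

lemma exchange_swap: "exchange t s = - exchange s t"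
  by (simp add: exchange_def)

lemma set_sum_exchange:
  "set_sum (x + d *\<^sub>R exchange s t) Z = set_sum x Z + d * (of_bool (s \<in> Z) - of_bool (t \<in> Z))"
proof -
  have "(\<Sum>u\<in>Z. of_bool (u = r)) = (of_bool (r \<in> Z) :: real)" for r
    by (simp add: of_bool_def)
  then show ?thesis
    by (simp add: set_sum_def exchange_nth sum.distrib sum_subtractf sum_distrib_left[symmetric])
qed

text \<open>Only the constraints of sets that contain \<open>t\<close> but not \<open>s\<close> become tighter when weight moves from
  \<open>t\<close> to \<open>s\<close>.\<close>

lemma exchange_in_base:
  assumes "x \<in> base_polyhedron p" "0 \<le> d"
    and "\<And>Z. t \<in> Z \<Longrightarrow> s \<notin> Z \<Longrightarrow> p Z + ereal d \<le> ereal (set_sum x Z)"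
  shows "x + d *\<^sub>R exchange s t \<in> base_polyhedron p"
proof -
  have "p Z \<le> ereal (set_sum (x + d *\<^sub>R exchange s t) Z)" for Z
  proof (cases "t \<in> Z \<and> s \<notin> Z")
    case True
    then show ?thesis using assms(3)[of Z] by (cases "p Z") (auto simp: set_sum_exchange)
  next
    case False
    then have "set_sum x Z \<le> set_sum (x + d *\<^sub>R exchange s t) Z"
      using assms(2) by (auto simp: set_sum_exchange)
    then show ?thesis using base_polyhedron_ge[OF assms(1), of Z]
      by (meson ereal_less_eq(3) order_trans)
  qed
  then show ?thesis using assms(1) by (auto simp: base_polyhedron_def set_sum_exchange)
qed

lemma slack_pos_outside_tight_hull:
  assumes "x \<in> base_polyhedron p" "s \<in> tight_hull p x t" "t \<in> Z" "s \<notin> Z"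
  shows "p Z < ereal (set_sum x Z)"
  using assms tight_hull_subset[of p x Z t] base_polyhedron_ge[OF assms(1), of Z]
  by (auto simp: tight_def order_less_le)

text \<open>For integral \<open>x\<close> and \<open>p\<close>, a positive slack is at least 1, so a whole unit can be moved.\<close>

lemma unit_exchange_in_base:
  assumes sm: "int_supermodular p" and x: "x \<in> base_polyhedron p" "x \<in> integral_vectors"
    and s: "s \<in> tight_hull p x t"
  shows "x + exchange s t \<in> base_polyhedron p"
proof -
  have "p Z + ereal 1 \<le> ereal (set_sum x Z)" if Z: "t \<in> Z" "s \<notin> Z" for Z
  proof -
    have lt: "p Z < ereal (set_sum x Z)"
      by (rule slack_pos_outside_tight_hull[OF x(1) s Z])
    have "set_sum x Z \<in> \<int>" unfolding set_sum_def
      using x(2) by (auto simp: integral_vectors_def intro: Ints_sum)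
    then obtain j where j: "set_sum x Z = of_int j" by (elim Ints_cases)
    have "p Z = -\<infinity> \<or> (\<exists>k::int. p Z = ereal (of_int k))"
      using sm by (simp add: int_supermodular_def)
    then show ?thesis using lt unfolding j by auto
  qed
  from exchange_in_base[OF x(1) _ this] show ?thesis by force
qed

lemma eventually_exchange_in_base:
  assumes x: "x \<in> base_polyhedron p" and s: "s \<in> tight_hull p x t"
  shows "\<forall>\<^sub>F d in at_right 0. x + d *\<^sub>R exchange s t \<in> base_polyhedron p"
proof -
  have "\<forall>\<^sub>F d in at_right 0. p Z + ereal d \<le> ereal (set_sum x Z)" if Z: "t \<in> Z" "s \<notin> Z" for Z
  proof -
    have lt: "p Z < ereal (set_sum x Z)"
      by (rule slack_pos_outside_tight_hull[OF x s Z])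
    show ?thesis
    proof (cases "p Z")
      case (real r)
      then have "r < set_sum x Z" using lt by simp
      then have "\<forall>\<^sub>F d in at_right 0. d < set_sum x Z - r"
        by (intro eventually_at_right_real[THEN eventually_mono]) auto
      then show ?thesis by (rule eventually_mono) (simp add: real)
    qed (use lt in auto)
  qed
  then have "\<forall>\<^sub>F d in at_right 0. \<forall>Z\<in>{Z. t \<in> Z \<and> s \<notin> Z}. p Z + ereal d \<le> ereal (set_sum x Z)"
    by (intro eventually_ball_finite) auto
  moreover have "\<forall>\<^sub>F d in at_right (0::real). 0 < d" by (rule eventually_at_right_less)
  ultimately show ?thesis
    by eventually_elim (auto intro!: exchange_in_base[OF x])
qed

section \<open>Integral optima of linear functionals on a boxed base-polyhedron\<close>

lemma set_sum_inner: "set_sum x Z = (\<chi> s. of_bool (s \<in> Z)) \<bullet> x"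
  by (simp add: set_sum_def inner_vec_def of_bool_def sum.inter_filter[symmetric] if_distrib[of "\<lambda>c. c * _"] cong: if_cong)

lemma base_polyhedron_eq:
  "base_polyhedron p = {x. ereal (set_sum x UNIV) = p UNIV} \<inter> (\<Inter>Z. {x. p Z \<le> ereal (set_sum x Z)})"
  using base_polyhedron_ge by (auto simp: base_polyhedron_def)

lemma closed_base_polyhedron: "closed (base_polyhedron p)"
  and convex_base_polyhedron: "convex (base_polyhedron p)"
proof -
  have "closed {x. p Z \<le> ereal (set_sum x Z)} \<and> convex {x. p Z \<le> ereal (set_sum x Z)}" for Z
    by (cases "p Z") (auto simp: set_sum_inner closed_halfspace_ge[simplified] convex_halfspace_ge[simplified])
  moreover have "closed {x. ereal (set_sum x UNIV) = p UNIV} \<and> convex {x. ereal (set_sum x UNIV) = p UNIV}"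
    by (cases "p UNIV") (auto simp: set_sum_inner closed_hyperplane convex_hyperplane)
  ultimately show "closed (base_polyhedron p)" "convex (base_polyhedron p)"
    unfolding base_polyhedron_eq by (auto intro!: closed_Int closed_INT convex_Int convex_INT)
qed

text \<open>Take a fractional coordinate \<open>s\<close> whose tight hull is as small as possible. The hull has an
  integral sum, so it contains a second fractional coordinate \<open>t\<close>. The hull of \<open>t\<close> is contained in
  that of \<open>s\<close>, and by minimality the two coincide.\<close>

lemma fractional_exchange_pair:
  assumes sm: "int_supermodular p" and x: "x \<in> base_polyhedron p"
    and frac: "x \<notin> integral_vectors"
  obtains s t where "s \<noteq> t" "x $ s \<notin> \<int>" "x $ t \<notin> \<int>"
    "s \<in> tight_hull p x t" "t \<in> tight_hull p x s"
proof -
  let ?D = "tight_hull p x"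
  obtain s0 where "x $ s0 \<notin> \<int>" using frac by (auto simp: integral_vectors_def)
  then obtain s where s: "x $ s \<notin> \<int>" and least: "\<And>u. x $ u \<notin> \<int> \<Longrightarrow> card (?D s) \<le> card (?D u)"
    using ex_has_least_nat[of "\<lambda>u. x $ u \<notin> \<int>" s0 "\<lambda>u. card (?D u)"] by blast
  have "\<exists>t\<in>?D s - {s}. x $ t \<notin> \<int>"
  proof (rule ccontr)
    assume "\<not> ?thesis"
    then have "(\<Sum>u\<in>?D s - {s}. x $ u) \<in> \<int>" by (auto intro: Ints_sum)
    moreover have "set_sum x (?D s) \<in> \<int>"
      by (rule set_sum_integral_if_tight[OF sm tight_tight_hull[OF sm x]])
    moreover have "set_sum x (?D s) = x $ s + (\<Sum>u\<in>?D s - {s}. x $ u)"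
      unfolding set_sum_def by (rule sum.remove) (auto simp: mem_tight_hull)
    ultimately show False using s Ints_diff by fastforce
  qed
  then obtain t where t: "t \<in> ?D s" "t \<noteq> s" "x $ t \<notin> \<int>" by auto
  have "?D t \<subseteq> ?D s" by (rule tight_hull_subset[OF tight_tight_hull[OF sm x] t(1)])
  then have "?D t = ?D s" using least[OF t(3)] by (simp add: card_seteq)
  then have "s \<in> ?D t" by (simp add: mem_tight_hull)
  with s t show ?thesis using that by metis
qed

lemma eventually_fractional_in_interval:
  fixes a b r e :: real
  assumes "a \<in> \<int>" "b \<in> \<int>" "a \<le> r" "r \<le> b" "e \<noteq> 0 \<Longrightarrow> r \<notin> \<int>"
  shows "\<forall>\<^sub>F d in at_right 0. a \<le> r + d * e \<and> r + d * e \<le> b"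
proof (cases "e = 0")
  case False
  then have "a < r" "r < b" using assms by (auto simp: order_less_le)
  moreover have "((\<lambda>d. r + d * e) \<longlongrightarrow> r + 0 * e) (at_right 0)"
    by (intro tendsto_intros)
  ultimately have "\<forall>\<^sub>F d in at_right 0. a < r + d * e" "\<forall>\<^sub>F d in at_right 0. r + d * e < b"
    by (auto intro: order_tendstoD)
  then show ?thesis by eventually_elim simp
qed (use assms in simp)

text \<open>A base-polyhedron cut by an integral box still has integral optima. The box constraints cause no
  trouble because the exchanges used only move coordinates that are fractional, hence strictly
  inside the box. The functional is constant along the exchange, since a nonzero slope would
  contradict minimality in one of the two directions.\<close>

lemma integral_linear_minimizer_in_box:
  assumes sm: "int_supermodular p"
    and ab: "a \<in> integral_vectors" "b \<in> integral_vectors"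
    and x: "x \<in> base_polyhedron p \<inter> cbox a b"
    and min: "\<And>y. y \<in> base_polyhedron p \<inter> cbox a b \<Longrightarrow> c \<bullet> x \<le> c \<bullet> y"
  obtains m where "m \<in> base_polyhedron p \<inter> cbox a b" "m \<in> integral_vectors" "c \<bullet> m = c \<bullet> x"
proof -
  define F where "F = base_polyhedron p \<inter> cbox a b \<inter> {y. c \<bullet> y = c \<bullet> x}"
  have "compact F" unfolding F_def
    by (intro compact_Int_closed closed_Int_compact closed_base_polyhedron compact_cbox closed_hyperplane)
  moreover have "convex F" unfolding F_def
    by (intro convex_Int convex_base_polyhedron convex_box convex_hyperplane)
  moreover have "F \<noteq> {}" using x by (auto simp: F_def)
  ultimately obtain m where m: "m extreme_point_of F"
    using extreme_point_exists_convex by blast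
  then have mF: "m \<in> base_polyhedron p" "m \<in> cbox a b" "c \<bullet> m = c \<bullet> x"
    by (auto simp: F_def extreme_point_of_def)
  have "m \<in> integral_vectors"
  proof (rule ccontr)
    assume "m \<notin> integral_vectors"
    then obtain s t where st: "s \<noteq> t" "m $ s \<notin> \<int>" "m $ t \<notin> \<int>"
      "s \<in> tight_hull p m t" "t \<in> tight_hull p m s"
      using fractional_exchange_pair[OF sm mF(1)] by metis
    have box: "\<forall>\<^sub>F d in at_right 0. m + d *\<^sub>R exchange u v \<in> cbox a b"
      if "m $ u \<notin> \<int>" "m $ v \<notin> \<int>" for u v
    proof -
      have "\<forall>\<^sub>F d in at_right 0. \<forall>i\<in>UNIV. a $ i \<le> m $ i + d * exchange u v $ i \<and> m $ i + d * exchange u v $ i \<le> b $ i"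
        using ab mF(2) that
        by (intro eventually_ball_finite ballI eventually_fractional_in_interval)
          (auto simp: integral_vectors_def mem_box_cart exchange_nth of_bool_def split: if_splits)
      then show ?thesis by (simp add: mem_box_cart)
    qed
    have "\<forall>\<^sub>F d::real in at_right 0. 0 < d \<and> m + d *\<^sub>R exchange s t \<in> base_polyhedron p \<inter> cbox a b
        \<and> m + d *\<^sub>R exchange t s \<in> base_polyhedron p \<inter> cbox a b"
      using st mF(1)
      by (simp add: eventually_conj_iff eventually_at_right_less eventually_exchange_in_base box)
    then obtain d :: real where d: "0 < d" "m + d *\<^sub>R exchange s t \<in> base_polyhedron p \<inter> cbox a b"
        "m - d *\<^sub>R exchange s t \<in> base_polyhedron p \<inter> cbox a b"
      using eventually_happens'[OF trivial_limit_at_right_real] by (auto simp: exchange_swap[of t s])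
    have "c \<bullet> (d *\<^sub>R exchange s t) = 0"
      using min[OF d(2)] min[OF d(3)] mF(3) by (simp only: inner_add_right inner_diff_right)
    then have "m + d *\<^sub>R exchange s t \<in> F" "m - d *\<^sub>R exchange s t \<in> F"
      using d mF(3) by (auto simp only: F_def inner_add_right inner_diff_right)
    moreover have "midpoint (m - d *\<^sub>R exchange s t) (m + d *\<^sub>R exchange s t) = m"
      by (simp add: midpoint_def scaleR_2[symmetric])
    moreover have "m - d *\<^sub>R exchange s t \<noteq> m + d *\<^sub>R exchange s t"
    proof
      assume "m - d *\<^sub>R exchange s t = m + d *\<^sub>R exchange s t"
      then have "(m - d *\<^sub>R exchange s t) $ s = (m + d *\<^sub>R exchange s t) $ s" by (rule arg_cong)
      then show False using d(1) st(1) by (simp add: exchange_nth)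
    qed
    ultimately show False
      using m midpoint_in_open_segment unfolding extreme_point_of_def by metis
  qed
  with mF that show ?thesis by auto
qed

section \<open>Unimprovable integral elements are decreasingly minimal\<close>

text \<open>The union \<open>Z\<close> of the tight hulls of the elements with \<open>m(t) > \<beta>\<close> is an optimality certificate:
  it is tight, and all positive excess of \<open>m\<close> over \<open>\<beta>\<close> lies inside \<open>Z\<close> with no deficit in \<open>Z\<close> to
  offset it. Hence the excess of \<open>m\<close> equals \<open>p(Z) - \<beta>|Z|\<close>, a lower bound for the excess of every
  element of the base-polyhedron.\<close>

lemma sum_excess_le_if_no_exchange:
  fixes \<beta> :: real
  assumes sm: "int_supermodular p" and m: "m \<in> base_polyhedron p" "m \<in> integral_vectors"
    and no_exchange: "\<And>s t. s \<in> tight_hull p m t \<Longrightarrow> m $ t \<le> m $ s + 1"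
    and x: "x \<in> base_polyhedron p" and \<beta>: "\<beta> \<in> \<int>"
  shows "(\<Sum>s\<in>UNIV. max 0 (m $ s - \<beta>)) \<le> (\<Sum>s\<in>UNIV. max 0 (x $ s - \<beta>))"
proof -
  define Z where "Z = \<Union>(tight_hull p m ` {t. m $ t > \<beta>})"
  have tight: "tight p m Z" unfolding Z_def
    by (rule tight_Union[OF sm m(1)]) (auto intro: tight_tight_hull[OF sm m(1)])
  have inside: "\<beta> \<le> m $ s" if sZ: "s \<in> Z" for s
  proof -
    obtain t where t: "m $ t > \<beta>" "s \<in> tight_hull p m t" using sZ by (auto simp: Z_def)
    have "m $ t \<in> \<int>" using m(2) by (auto simp: integral_vectors_def)
    \<comment> \<open>By integrality \<open>m(t) \<ge> \<beta> + 1\<close>, which leaves room for the loss of 1 from \<open>t\<close> to \<open>s\<close>.\<close>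
    with \<beta> obtain i j where "m $ t = of_int i" "\<beta> = of_int j" by (elim Ints_cases)
    then show ?thesis using t(1) no_exchange[OF t(2)] by simp
  qed
  have outside: "m $ s \<le> \<beta>" if "s \<notin> Z" for s
    using that mem_tight_hull[of s p m] by (force simp: Z_def)
  have "(\<Sum>s\<in>UNIV. max 0 (m $ s - \<beta>)) = (\<Sum>s\<in>Z. m $ s - \<beta>)"
    by (rule sum.mono_neutral_cong_right) (use inside outside in \<open>auto simp: max_absorb1 max_absorb2\<close>)
  also have "\<dots> \<le> (\<Sum>s\<in>Z. x $ s - \<beta>)"
    using base_polyhedron_ge[OF x, of Z] tight by (simp add: tight_def set_sum_def sum_subtractf)
  also have "\<dots> \<le> (\<Sum>s\<in>Z. max 0 (x $ s - \<beta>))" by (rule sum_mono) simp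
  also have "\<dots> \<le> (\<Sum>s\<in>UNIV. max 0 (x $ s - \<beta>))" by (rule sum_mono2) auto
  finally show ?thesis .
qed

text \<open>At the first difference, a larger entry of \<open>xs\<close> is impossible: taking the entry of \<open>ys\<close> as the
  threshold, the rest of the decreasing list \<open>ys\<close> has no excess at all, while \<open>xs\<close> has some.
  Equal first entries contribute equally to both sides and can be cancelled.\<close>

lemma lexord_if_sum_excess_le:
  fixes xs ys :: "real list"
  assumes "length xs = length ys" "sorted_wrt (\<ge>) ys" "set ys \<subseteq> \<int>"
    and "\<And>\<beta>. \<beta> \<in> \<int> \<Longrightarrow> (\<Sum>a\<leftarrow>xs. max 0 (a - \<beta>)) \<le> (\<Sum>a\<leftarrow>ys. max 0 (a - \<beta>))"
  shows "xs = ys \<or> (xs, ys) \<in> lexord {(a, b). a < b}"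
  using assms
proof (induction xs ys rule: list_induct2)
  case (Cons x xs y ys)
  consider "x < y" | "x = y" | "y < x" by linarith
  then show ?case
  proof cases
    case 2
    then have "xs = ys \<or> (xs, ys) \<in> lexord {(a, b). a < b}"
      using Cons.prems by (intro Cons.IH) auto
    with 2 show ?thesis by auto
  next
    case 3
    have "(\<Sum>a\<leftarrow>ys. max 0 (a - y)) = (\<Sum>a\<leftarrow>ys. 0)"
      by (rule arg_cong[of _ _ sum_list], rule map_cong[OF refl]) (use Cons.prems(1) in auto)
    moreover have "0 \<le> (\<Sum>a\<leftarrow>xs. max 0 (a - y))" by (rule sum_list_nonneg) auto
    ultimately show ?thesis using Cons.prems(3)[of y] Cons.prems(2) 3 by simp
  qed simp
qed simp

lemma mset_sorted_desc: "mset (sorted_desc x) = image_mset (($) x) (mset_set UNIV)"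
  by (simp add: sorted_desc_def)

lemma sum_list_sorted_desc: "(\<Sum>a\<leftarrow>sorted_desc x. f a) = (\<Sum>s\<in>UNIV. f (x $ s))"
proof -
  have "(\<Sum>a\<leftarrow>sorted_desc x. f a) = (\<Sum>a\<in>#mset (sorted_desc x). f a)"
    by (metis mset_map sum_mset_sum_list)
  then show ?thesis by (simp add: mset_sorted_desc sum_unfold_sum_mset image_mset.compositionality comp_def)
qed

lemma dec_min_if_sum_excess_le:
  assumes m: "m \<in> P" and P: "P \<subseteq> integral_vectors"
    and le: "\<And>x \<beta>. x \<in> P \<Longrightarrow> \<beta> \<in> \<int> \<Longrightarrow>
      (\<Sum>s\<in>UNIV. max 0 (m $ s - \<beta>)) \<le> (\<Sum>s\<in>UNIV. max 0 (x $ s - \<beta>))"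
  shows "dec_min m P"
  unfolding dec_min_def
proof (intro conjI ballI m)
  fix x assume x: "x \<in> P"
  show "sorted_desc m = sorted_desc x \<or> (sorted_desc m, sorted_desc x) \<in> lexord {(a, b). a < b}"
  proof (rule lexord_if_sum_excess_le)
    show "length (sorted_desc m) = length (sorted_desc x)"
      by (metis mset_sorted_desc size_mset size_image_mset)
    show "sorted_wrt (\<ge>) (sorted_desc x)"
      by (simp add: sorted_desc_def sorted_wrt_rev)
    show "set (sorted_desc x) \<subseteq> \<int>"
      using x P by (auto simp: set_mset_mset[symmetric] mset_sorted_desc integral_vectors_def
          simp del: set_mset_mset)
  qed (simp add: sum_list_sorted_desc le[OF x])
qed

section \<open>Minimizers of the piecewise-linear square sum\<close>

lemma phi_bar_linear:
  assumes "real_of_int k \<le> r" "r \<le> real_of_int k + 1"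
  shows "phi_bar r = (2 * of_int k + 1) * r - of_int k * (of_int k + 1)"
  using phi_bar_segment[of "r - of_int k" k] assms by (simp add: power2_eq_square algebra_simps)

text \<open>Moving a unit from \<open>t\<close> to \<open>s\<close> changes the sum of squares by \<open>2 (m(s) - m(t) + 1)\<close>.\<close>

lemma W_bar_minimizer_no_exchange:
  assumes sm: "int_supermodular p" and m: "m \<in> base_polyhedron p" "m \<in> integral_vectors"
    and min: "\<And>y. y \<in> base_polyhedron p \<Longrightarrow> W_bar m \<le> W_bar y"
    and s: "s \<in> tight_hull p m t"
  shows "m $ t \<le> m $ s + 1"
proof (cases "s = t")
  case False
  let ?y = "m + exchange s t"
  have sq: "phi_bar (of_int k) = (of_int k)\<^sup>2" for k using phi_bar_segment[of 0 k] by simp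
  have "m $ s \<in> \<int>" "m $ t \<in> \<int>" using m(2) by (auto simp: integral_vectors_def)
  then obtain i j where ij: "m $ s = of_int i" "m $ t = of_int j" by (elim Ints_cases)
  have split: "W_bar z = phi_bar (z $ s) + phi_bar (z $ t) + (\<Sum>u\<in>UNIV - {s,t}. phi_bar (z $ u))" for z
    using sum.subset_diff[of "{s,t}" UNIV "\<lambda>u. phi_bar (z $ u)"] False
    by (simp add: W_bar_def)
  have "(\<Sum>u\<in>UNIV - {s,t}. phi_bar (?y $ u)) = (\<Sum>u\<in>UNIV - {s,t}. phi_bar (m $ u))"
    by (rule sum.cong) (auto simp: exchange_nth)
  moreover have "?y $ s = of_int (i + 1)" "?y $ t = of_int (j - 1)"
    using False by (auto simp: exchange_nth ij)
  moreover have "W_bar m \<le> W_bar ?y" by (rule min[OF unit_exchange_in_base[OF sm m s]])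
  ultimately have "(real_of_int i)\<^sup>2 + (of_int j)\<^sup>2 \<le> (of_int (i + 1))\<^sup>2 + (of_int (j - 1))\<^sup>2"
    by (simp only: split ij sq)
  then show ?thesis by (simp add: ij power2_eq_square algebra_simps)
qed simp

lemma integral_W_bar_minimizer_dec_min:
  assumes sm: "int_supermodular p" and m: "m \<in> base_polyhedron p" "m \<in> integral_vectors"
    and min: "\<And>y. y \<in> base_polyhedron p \<Longrightarrow> W_bar m \<le> W_bar y"
  shows "dec_min m (base_polyhedron p \<inter> integral_vectors)"
proof (rule dec_min_if_sum_excess_le)
  fix x \<beta> assume "x \<in> base_polyhedron p \<inter> integral_vectors" "(\<beta>::real) \<in> \<int>"
  then show "(\<Sum>s\<in>UNIV. max 0 (m $ s - \<beta>)) \<le> (\<Sum>s\<in>UNIV. max 0 (x $ s - \<beta>))"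
    by (intro sum_excess_le_if_no_exchange[OF sm m W_bar_minimizer_no_exchange[OF sm m min]]) auto
qed (use m in auto)

theorem theorem4p4:
  fixes p :: "'s::finite set \<Rightarrow> ereal" and x\<^sub>R :: "real ^ 's"
  assumes "int_supermodular p" and "p UNIV \<noteq> -\<infinity>"
    and "is_arg_min W_bar (\<lambda>x. x \<in> base_polyhedron p) x\<^sub>R"
  shows "\<exists>m. dec_min m (base_polyhedron p \<inter> integral_vectors) \<and>
             (\<forall>s. of_int \<lfloor>x\<^sub>R $ s\<rfloor> \<le> m $ s \<and> m $ s \<le> of_int \<lceil>x\<^sub>R $ s\<rceil>)"
proof -
  let ?B = "base_polyhedron p"
  have xB: "x\<^sub>R \<in> ?B" and min: "\<And>y. y \<in> ?B \<Longrightarrow> W_bar x\<^sub>R \<le> W_bar y"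
    using assms(3) by (auto simp: is_arg_min_linorder)
  define a :: "real ^ 's" where "a = (\<chi> s. of_int \<lfloor>x\<^sub>R $ s\<rfloor>)"
  define b :: "real ^ 's" where "b = (\<chi> s. of_int \<lceil>x\<^sub>R $ s\<rceil>)"
  \<comment> \<open>\<open>c\<close> collects the slopes \<open>2k + 1\<close> of the segments over \<open>[k, k + 1]\<close>. An integral coordinate of
    \<open>x\<^sub>R\<close> is fixed in the box, and the segment to its right serves as well as the one to its left.\<close>
  define c :: "real ^ 's" where "c = (\<chi> s. 2 * of_int \<lfloor>x\<^sub>R $ s\<rfloor> + 1)"
  define e where "e = (\<Sum>s\<in>UNIV. real_of_int \<lfloor>x\<^sub>R $ s\<rfloor> * (of_int \<lfloor>x\<^sub>R $ s\<rfloor> + 1))"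
  have W: "W_bar y = c \<bullet> y - e" if "y \<in> cbox a b" for y
  proof -
    have "phi_bar (y $ s) = c $ s * y $ s - of_int \<lfloor>x\<^sub>R $ s\<rfloor> * (of_int \<lfloor>x\<^sub>R $ s\<rfloor> + 1)" for s
    proof -
      have "of_int \<lfloor>x\<^sub>R $ s\<rfloor> \<le> y $ s" "y $ s \<le> of_int \<lceil>x\<^sub>R $ s\<rceil>"
        using that by (auto simp: mem_box_cart a_def b_def)
      moreover have "\<lceil>x\<^sub>R $ s\<rceil> \<le> \<lfloor>x\<^sub>R $ s\<rfloor> + 1" by linarith
      ultimately show ?thesis unfolding c_def vec_lambda_beta by (intro phi_bar_linear) linarith+
    qed
    then show ?thesis by (simp add: W_bar_def inner_vec_def sum_subtractf e_def)
  qed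
  have xbox: "x\<^sub>R \<in> cbox a b" by (simp add: mem_box_cart a_def b_def)
  obtain m where m: "m \<in> ?B \<inter> cbox a b" "m \<in> integral_vectors" "c \<bullet> m = c \<bullet> x\<^sub>R"
  proof (rule integral_linear_minimizer_in_box[OF assms(1), of a b x\<^sub>R c])
    show "a \<in> integral_vectors" "b \<in> integral_vectors"
      by (auto simp: integral_vectors_def a_def b_def)
    show "x\<^sub>R \<in> ?B \<inter> cbox a b" using xB xbox by simp
    show "c \<bullet> x\<^sub>R \<le> c \<bullet> y" if "y \<in> ?B \<inter> cbox a b" for y
      using min[of y] W[of y] W[OF xbox] that by auto
  qed auto
  have "W_bar m = W_bar x\<^sub>R" using W[of m] W[OF xbox] m by auto
  then have "dec_min m (?B \<inter> integral_vectors)"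
    using integral_W_bar_minimizer_dec_min[OF assms(1) _ m(2)] m(1) min by simp
  moreover have "\<forall>s. of_int \<lfloor>x\<^sub>R $ s\<rfloor> \<le> m $ s \<and> m $ s \<le> of_int \<lceil>x\<^sub>R $ s\<rceil>"
    using m(1) by (auto simp: mem_box_cart a_def b_def)
  ultimately show ?thesis by blast
qed

end
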